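(* Let $L$ be a frame. The following are equivalent. (1) The frame $L$ is totally spatial. (2) The frame $\mathsf{S}(L)^{op}$ is spatial. (3) The map $\mathsf{pt}:\mathsf{S}(L)\to\mathsf{sob}[\mathcal{P}(\mathsf{pt}(L))]$, $S\mapsto \mathsf{pt}(S)=\mathsf{pt}(L)\cap S$, is an isomorphism (of coframes). (4) Every Boolean sublocale $\mathfrak{b}(x)$ of $L$ other than $\{1\}$ contains at least one prime of $L$. (5) The frame $L$ is spatial and every element of $L$ other than $1$ has an essential prime. (6) The frame $L$ is spatial and for every element $a\neq 1$ of $L$ there is a prime of $L$ of the form $y\to a$ for some $y\in L$. (7) Every element $a\in L$ is the meet of its essential primes. (8) The frame $L$ is spatial and every closed subspace of $\mathsf{pt}(L)$ has a discrete dense subspace.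
   Context: For a frame $L$, a prime is an element $p\neq 1$ such that $x\wedge y\leq p$ implies $x\leq p$ or $y\leq p$. $\mathsf{pt}(L)$ is the set of primes of $L$, topologized with open sets $\{p\in\mathsf{pt}(L): a\nleq p\}$, $a\in L$. A frame is spatial if every element is a meet of primes. For $a\in L$, ${\uparrow}a=\{x\in L: a\leq x\}$ and $\mathsf{pt}({\uparrow}a)={\uparrow}a\cap\mathsf{pt}(L)$. A sublocale of $L$ is a subset $S\subseteq L$ closed under arbitrary meets (so $1\in S$) such that $s\in S$ implies $x\to s\in S$ for all $x\in L$ ($\to$ is Heyting implication); it is itself a frame in the inherited order. $\mathsf{S}(L)$ is the coframe of all sublocales ordered by inclusion, $\mathsf{S}(L)^{op}$ is the opposite frame. For a sublocale $S$, the primes of the frame $S$ are exactly the elements of $\mathsf{pt}(S)=\mathsf{pt}(L)\cap S$. $L$ is totally spatial if all its sublocales are spatial frames. For $x\in L$, $\mathfrak{b}(x)$ is the smallest sublocale containing $x$; it equals $\{y\to x:y\in L\}$. The Boolean sublocales of $L$ are those of the form $\mathfrak{b}(x)$. A space is sober if every irreducible closed set is the closure of a unique point; $\mathsf{sob}[\mathcal{P}(\mathsf{pt}(L))]$ is the coframe of sober subspaces of $\mathsf{pt}(L)$ ordered by inclusion. For $a\in L$ which is the meet of the primes above it, a prime $p$ is an essential prime of $a$ if $a\leq p$ and $\bigwedge(\mathsf{pt}({\uparrow}a)\setminus{\uparrow}p)\nleq p$, i.e. $\bigwedge\{q\in\mathsf{pt}({\uparrow}a): p\nleq q\}\nleq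 p$. *)

theory Defs
  imports
    "HOL-Library.Lub_Glb"
    "HOL-Library.Dual_Ordered_Lattice"
    "HOL-Analysis.Abstract_Topology"
begin

class frame = complete_lattice +
  assumes inf_Sup_frame: "inf a (Sup B) = (SUP b\<in>B. inf a b)"

definition heyting_imp :: "'a::frame \<Rightarrow> 'a \<Rightarrow> 'a" where
  "heyting_imp x y = Sup {z. inf z x \<le> y}"

lemma le_heyting_imp_iff: "z \<le> heyting_imp x y \<longleftrightarrow> inf z x \<le> y"
proof
  assume "z \<le> heyting_imp x y"
  then have "inf z x \<le> inf x (Sup {z. inf z x \<le> y})"
    unfolding heyting_imp_def by (metis inf_commute inf_mono order_refl)
  also have "\<dots> \<le> y"
    by (subst inf_Sup_frame) (auto intro!: SUP_least simp: inf_commute)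
  finally show "inf z x \<le> y" .
qed (auto simp: heyting_imp_def intro: Sup_upper)

text \<open>Sublocales, lattices of sublocales and lattices of subspaces are all represented as subsets
  \<open>A\<close> of an ordered type, with the inherited order. Primes and spatiality are therefore
  expressed by meets computed within \<open>A\<close>: \<open>isGlb A X m\<close> says that \<open>m\<close> is the greatest lower bound
  of \<open>X\<close> in \<open>A\<close>. In particular \<open>isGlb A {} p\<close> says that \<open>p\<close> is the top element of \<open>A\<close>.\<close>

definition primes :: "'a::order set \<Rightarrow> 'a set" where
  "primes A = {p \<in> A. \<not> isGlb A {} p \<and>
     (\<forall>x\<in>A. \<forall>y\<in>A. \<forall>m. isGlb A {x, y} m \<and> m \<le> p \<longrightarrow> x \<le> p \<or> y \<le> p)}"

definition spatial :: "'a::order set \<Rightarrow> bool" where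
  "spatial A \<longleftrightarrow> (\<forall>a\<in>A. \<exists>P\<subseteq>primes A. isGlb A P a)"

definition pt :: "'a::frame set" where
  "pt = primes UNIV"

lemma isGlb_UNIV_iff: "isGlb UNIV X m \<longleftrightarrow> m = Inf X" for m :: "'a::complete_lattice"
  unfolding isGlb_def greatestP_def isLb_def setge_def setle_def
  by (auto intro: Inf_lower Inf_greatest antisym)

lemma mem_pt_iff:
  "p \<in> pt \<longleftrightarrow> p \<noteq> top \<and> (\<forall>x y. inf x y \<le> p \<longrightarrow> x \<le> p \<or> y \<le> p)"
  by (auto simp: pt_def primes_def isGlb_UNIV_iff)

definition pt_space :: "'a::frame topology" where
  "pt_space = topology (\<lambda>U. \<exists>a. U = {p \<in> pt. \<not> a \<le> p})"

lemma openin_pt_space: "openin pt_space U \<longleftrightarrow> (\<exists>a. U = {p \<in> pt. \<not> a \<le> p})"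
proof -
  have "istopology (\<lambda>U. \<exists>a::'a. U = {p \<in> pt. \<not> a \<le> p})"
    unfolding istopology_def
  proof (intro conjI allI impI)
    fix S T :: "'a set"
    assume "\<exists>a. S = {p \<in> pt. \<not> a \<le> p}" and "\<exists>a. T = {p \<in> pt. \<not> a \<le> p}"
    then obtain a b where "S = {p \<in> pt. \<not> a \<le> p}" "T = {p \<in> pt. \<not> b \<le> p}" by blast
    then have "S \<inter> T = {p \<in> pt. \<not> inf a b \<le> p}"
      unfolding mem_pt_iff by (blast intro: le_infI1 le_infI2)
    then show "\<exists>a. S \<inter> T = {p \<in> pt. \<not> a \<le> p}" by blast
  next
    fix K :: "'a set set"
    assume "\<forall>U\<in>K. \<exists>a. U = {p \<in> pt. \<not> a \<le> p}"
    then obtain f where "\<And>U. U \<in> K \<Longrightarrow> U = {p \<in> pt. \<not> f U \<le> p}" by metis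
    then have "\<Union>K = {p \<in> pt. \<not> Sup (f ` K) \<le> p}"
      by (simp add: SUP_le_iff) blast
    then show "\<exists>a. \<Union>K = {p \<in> pt. \<not> a \<le> p}" by blast
  qed
  then show ?thesis
    by (simp add: pt_space_def)
qed

lemma topspace_pt_space: "topspace pt_space = pt"
proof -
  have "openin pt_space (pt :: 'a set)"
    unfolding openin_pt_space by (rule exI[of _ top]) (simp add: set_eq_iff, metis mem_pt_iff top_unique)
  then show ?thesis
    unfolding topspace_def openin_pt_space by blast
qed

definition sublocales :: "'a::frame set set" where
  "sublocales = {S. (\<forall>X\<subseteq>S. Inf X \<in> S) \<and> (\<forall>s\<in>S. \<forall>x. heyting_imp x s \<in> S)}"

definition totally_spatial :: "'a::frame itself \<Rightarrow> bool" where
  "totally_spatial _ \<longleftrightarrow> (\<forall>S\<in>(sublocales :: 'a set set). spatial S)"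

definition boolean_sublocale :: "'a::frame \<Rightarrow> 'a set" where
  "boolean_sublocale x = \<Inter>{S \<in> sublocales. x \<in> S}"

lemma boolean_sublocale_in_sublocales: "boolean_sublocale x \<in> sublocales"
  unfolding boolean_sublocale_def sublocales_def by blast

text \<open>The paper speaks of essential primes only for elements that are the meet of the primes above
  them; here other elements have no essential primes.\<close>

definition essential_prime :: "'a::frame \<Rightarrow> 'a \<Rightarrow> bool" where
  "essential_prime a p \<longleftrightarrow> a = Inf (pt \<inter> {a..}) \<and> p \<in> pt \<and> a \<le> p \<and>
     \<not> Inf ((pt \<inter> {a..}) - {p..}) \<le> p"

definition irreducible_closedin :: "'a topology \<Rightarrow> 'a set \<Rightarrow> bool" where
  "irreducible_closedin X C \<longleftrightarrow> closedin X C \<and> C \<noteq> {} \<and>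
     (\<forall>A B. closedin X A \<and> closedin X B \<and> C = A \<union> B \<longrightarrow> C = A \<or> C = B)"

definition sober :: "'a topology \<Rightarrow> bool" where
  "sober X \<longleftrightarrow> (\<forall>C. irreducible_closedin X C \<longrightarrow>
     (\<exists>!x. x \<in> topspace X \<and> C = X closure_of {x}))"

definition sober_subspaces :: "'a topology \<Rightarrow> 'a set set" where
  "sober_subspaces X = {Y. Y \<subseteq> topspace X \<and> sober (subtopology X Y)}"

definition coframe_hom :: "'a::order set \<Rightarrow> 'b::order set \<Rightarrow> ('a \<Rightarrow> 'b) \<Rightarrow> bool" where
  "coframe_hom A B f \<longleftrightarrow> f \<in> A \<rightarrow> B \<and>
     (\<forall>X m. X \<subseteq> A \<and> isGlb A X m \<longrightarrow> isGlb B (f ` X) (f m)) \<and>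
     (\<forall>X j. finite X \<and> X \<subseteq> A \<and> isLub A X j \<longrightarrow> isLub B (f ` X) (f j))"

definition coframe_iso :: "'a::order set \<Rightarrow> 'b::order set \<Rightarrow> ('a \<Rightarrow> 'b) \<Rightarrow> bool" where
  "coframe_iso A B f \<longleftrightarrow> bij_betw f A B \<and> coframe_hom A B f \<and> coframe_hom B A (inv_into A f)"

definition all_equivalent :: "bool list \<Rightarrow> bool" where
  "all_equivalent Ps \<longleftrightarrow> (\<forall>P\<in>set Ps. \<forall>Q\<in>set Ps. P \<longleftrightarrow> Q)"

end

theory Submission
  imports Defs
begin

text \<open>
  Everything revolves around the condition that every nontrivial Boolean sublocale \<open>b(x)\<close> contains
  a prime. Since \<open>b(x) = {y \<rightarrow> x | y}\<close>, the primes in \<open>b(x)\<close> are the primes of the form \<open>y \<rightarrow> x\<close>,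
  and when \<open>x\<close> is a meet of primes these are exactly the essential primes of \<open>x\<close>
  (\<open>essential_prime_iff\<close>): every prime above \<open>x\<close> is above \<open>y\<close> or above \<open>y \<rightarrow> x\<close>, so if \<open>y \<rightarrow> x\<close>
  is prime, the primes above \<open>x\<close> that are not above it have a meet above \<open>y\<close>; and conversely the
  meet of the primes above \<open>x\<close> that are not above an essential prime \<open>p\<close> is a \<open>y\<close> with \<open>p = y \<rightarrow> x\<close>.

  The condition bootstraps itself (\<open>Inf_boolean_primes\<close>): let \<open>m\<close> be the meet of the primes in
  \<open>b(a)\<close>. Unless \<open>m = a\<close>, there is a prime in \<open>b(m \<rightarrow> a)\<close>; it lies in \<open>b(a)\<close>, hence above \<open>m\<close>; but
  an element of \<open>b(m \<rightarrow> a)\<close> above \<open>m\<close> is the top, which is not prime. Thus every \<open>a\<close> is the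
  meet of the primes in \<open>b(a)\<close>, which gives at once that every sublocale containing \<open>a\<close> has enough primes, that the frame is spatial, and
  that \<open>a\<close> is the meet of its essential primes.

  For the topological condition, a closed set of primes consists of the primes above its meet
  \<open>a\<close>, and a subset is dense in it iff it has the same meet. The essential primes of \<open>a\<close> are
  minimal among the primes above \<open>a\<close>, so they form a discrete set, dense if their meet is \<open>a\<close>.
  Conversely each point of a discrete dense set is an essential prime.

  For the two conditions on the lattice of sublocales, a set \<open>Y\<close> of primes generates the sublocale
  \<open>meets Y\<close> of its meets. Its primes are all in \<open>Y\<close> iff \<open>Y\<close> is sober. Hence sober subspaces
  correspond to the spatial sublocales, and the correspondence reaches every sublocale iff the frame
  is totally spatial. In the opposite of the lattice of sublocales the primes are the
  sublocales \<open>{1, p}\<close> for \<open>p\<close> prime, because the open and the closed sublocale of an element join to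
  the whole frame. So a sublocale is a join of such sublocales iff it is generated
  by its primes.
\<close>

section \<open>Heyting implication and primes\<close>

lemma eqI_below:
  fixes a b :: "'a::order"
  assumes "\<And>z. z \<le> a \<longleftrightarrow> z \<le> b"
  shows "a = b"
  using assms by (meson order.antisym order_refl)

lemma heyting_imp_Inf: "heyting_imp x (Inf A) = Inf (heyting_imp x ` A)"
  by (rule eqI_below) (simp add: le_heyting_imp_iff le_Inf_iff)

lemma heyting_imp_inf: "heyting_imp x (inf a b) = inf (heyting_imp x a) (heyting_imp x b)"
  by (rule eqI_below) (simp add: le_heyting_imp_iff)

lemma heyting_imp_heyting_imp: "heyting_imp x (heyting_imp y z) = heyting_imp (inf x y) z"
  by (rule eqI_below) (simp add: le_heyting_imp_iff inf_assoc)

lemma heyting_imp_eq_top_iff: "heyting_imp x y = top \<longleftrightarrow> x \<le> y"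
  by (metis inf_top_left le_heyting_imp_iff top_unique)

lemma le_heyting_imp: "y \<le> heyting_imp x y"
  by (simp add: le_heyting_imp_iff le_infI1)

lemma heyting_imp_inf_le: "inf (heyting_imp x y) x \<le> y"
  using le_heyting_imp_iff by blast

lemma heyting_imp_top [simp]: "heyting_imp top x = x"
  by (rule eqI_below) (simp add: le_heyting_imp_iff)

lemma pt_ne_top: "p \<in> pt \<Longrightarrow> p \<noteq> top"
  by (simp add: mem_pt_iff)

lemma pt_inf_le_iff: "p \<in> pt \<Longrightarrow> inf x y \<le> p \<longleftrightarrow> x \<le> p \<or> y \<le> p"
  unfolding mem_pt_iff by (meson le_infI1 le_infI2)

lemma heyting_imp_pt:
  assumes "p \<in> pt"
  shows "heyting_imp x p = (if x \<le> p then top else p)"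
  by (rule eqI_below) (use assms in \<open>auto simp: le_heyting_imp_iff pt_inf_le_iff\<close>)

text \<open>This is how primes arise as implications: an element \<open>y\<close> that is not below \<open>p\<close> but meets \<open>p\<close>
  below \<open>a\<close> has \<open>p\<close> as its pseudocomplement relative to \<open>a\<close>.\<close>

lemma pt_eq_heyting_impI:
  assumes "p \<in> pt" "a \<le> p" "\<not> y \<le> p" "inf p y \<le> a"
  shows "p = heyting_imp y a"
proof (rule antisym)
  show "p \<le> heyting_imp y a"
    using assms(4) by (simp add: le_heyting_imp_iff)
  have "inf (heyting_imp y a) y \<le> p"
    using heyting_imp_inf_le assms(2) order_trans by blast
  then show "heyting_imp y a \<le> p"
    using assms by (simp add: pt_inf_le_iff)
qed

lemma not_le_heyting_imp_pt:
  assumes "heyting_imp y a \<in> pt"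
  shows "\<not> y \<le> heyting_imp y a"
  using pt_ne_top[OF assms] by (simp add: le_heyting_imp_iff heyting_imp_eq_top_iff)

section \<open>Sublocales and their primes\<close>

lemma sublocale_Inf: "S \<in> sublocales \<Longrightarrow> X \<subseteq> S \<Longrightarrow> Inf X \<in> S"
  by (simp add: sublocales_def)

lemma sublocale_heyting_imp: "S \<in> sublocales \<Longrightarrow> s \<in> S \<Longrightarrow> heyting_imp x s \<in> S"
  by (simp add: sublocales_def)

lemma sublocale_top: "S \<in> sublocales \<Longrightarrow> top \<in> S"
  using sublocale_Inf[of S "{}"] by simp

lemma sublocale_inf: "S \<in> sublocales \<Longrightarrow> x \<in> S \<Longrightarrow> y \<in> S \<Longrightarrow> inf x y \<in> S"
  using sublocale_Inf[of S "{x, y}"] by simp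

lemma isGlb_iff: "isGlb A X m \<longleftrightarrow> m \<in> A \<and> (\<forall>x\<in>X. m \<le> x) \<and> (\<forall>l\<in>A. (\<forall>x\<in>X. l \<le> x) \<longrightarrow> l \<le> m)"
  unfolding isGlb_def greatestP_def isLb_def setge_def setle_def by auto

lemma isLub_iff: "isLub A X m \<longleftrightarrow> m \<in> A \<and> (\<forall>x\<in>X. x \<le> m) \<and> (\<forall>u\<in>A. (\<forall>x\<in>X. x \<le> u) \<longrightarrow> m \<le> u)"
  unfolding isLub_def leastP_def isUb_def setge_def setle_def by auto

lemma isGlb_sublocale_iff:
  assumes "S \<in> sublocales" "X \<subseteq> S"
  shows "isGlb S X m \<longleftrightarrow> m = Inf X"
proof
  assume "isGlb S X m"
  then show "m = Inf X"
    using sublocale_Inf[OF assms] unfolding isGlb_iff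
    by (meson Inf_greatest Inf_lower antisym)
next
  assume "m = Inf X"
  then show "isGlb S X m"
    using sublocale_Inf[OF assms] by (simp add: isGlb_iff Inf_lower le_Inf_iff)
qed

text \<open>A prime \<open>p\<close> of \<open>S\<close> is prime in the whole frame because, when \<open>x \<sqinter> y \<le> p\<close>, both factors can
  be enlarged to elements of \<open>S\<close>: first \<open>x\<close> to \<open>y \<rightarrow> p\<close>, then \<open>y\<close> to \<open>(y \<rightarrow> p) \<rightarrow> p\<close>.\<close>

lemma primes_sublocale:
  assumes S: "S \<in> sublocales"
  shows "primes S = pt \<inter> S"
proof (intro set_eqI iffI)
  fix p assume p: "p \<in> primes S"
  then have pS: "p \<in> S" by (simp add: primes_def)
  have prime: "x \<le> p \<or> y \<le> p" if "x \<in> S" "y \<in> S" "inf x y \<le> p" for x y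
  proof -
    have "isGlb S {x, y} (inf x y)"
      using that S by (simp add: isGlb_sublocale_iff)
    then show ?thesis
      using p that unfolding primes_def by blast
  qed
  have "p \<noteq> top"
    using p S isGlb_sublocale_iff[OF S, of "{}"] by (auto simp: primes_def)
  moreover have "x \<le> p \<or> y \<le> p" if xy: "inf x y \<le> p" for x y
  proof -
    let ?u = "heyting_imp y p" and ?v = "heyting_imp (heyting_imp y p) p"
    have "inf ?u ?v \<le> p"
      using heyting_imp_inf_le[of ?u p] by (simp add: inf_commute)
    then have "?u \<le> p \<or> ?v \<le> p"
      using prime sublocale_heyting_imp[OF S] pS by blast
    moreover have "x \<le> ?u" "y \<le> ?v"
      using xy heyting_imp_inf_le[of y p] by (auto simp: le_heyting_imp_iff inf_commute)
    ultimately show ?thesis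
      by (meson order_trans)
  qed
  ultimately show "p \<in> pt \<inter> S"
    using pS by (simp add: mem_pt_iff)
next
  fix p assume p: "p \<in> pt \<inter> S"
  then show "p \<in> primes S"
    using pt_ne_top[of p] isGlb_sublocale_iff[OF S, of "{}"]
    by (auto simp: primes_def isGlb_sublocale_iff S pt_inf_le_iff)
qed

text \<open>A meet of some elements of \<open>Y\<close> is also the meet of all the elements of \<open>Y\<close> above it. This
  canonical choice avoids a quantifier over subsets of \<open>Y\<close>.\<close>

definition meets :: "'a::complete_lattice set \<Rightarrow> 'a set" where
  "meets Y = {m. m = Inf (Y \<inter> {m..})}"

lemma Inf_in_meets:
  assumes "X \<subseteq> Y"
  shows "Inf X \<in> meets Y"
proof -
  have "Inf (Y \<inter> {Inf X..}) \<le> Inf X"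
    using assms by (intro Inf_superset_mono) (auto simp: Inf_lower)
  moreover have "Inf X \<le> Inf (Y \<inter> {Inf X..})"
    by (rule Inf_greatest) simp
  ultimately show ?thesis
    unfolding meets_def mem_Collect_eq by (rule antisym[rotated])
qed

lemma subset_meets: "Y \<subseteq> meets Y"
proof
  fix y assume "y \<in> Y"
  then show "y \<in> meets Y"
    using Inf_in_meets[of "{y}" Y] by simp
qed

lemma in_meets_iff: "m \<in> meets Y \<longleftrightarrow> (\<exists>X\<subseteq>Y. m = Inf X)"
  using Inf_in_meets unfolding meets_def by blast

lemma meets_subset_sublocale:
  assumes "S \<in> sublocales" "Y \<subseteq> S"
  shows "meets Y \<subseteq> S"
proof
  fix m assume "m \<in> meets Y"
  then obtain X where "X \<subseteq> Y" "m = Inf X"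
    unfolding in_meets_iff by blast
  then show "m \<in> S"
    using assms sublocale_Inf[of S X] by blast
qed

text \<open>The value of \<open>x \<rightarrow> p\<close> at a prime \<open>p\<close> is \<open>p\<close> or the top, and implication preserves meets in
  its second argument; so meets of primes are stable under implication.\<close>

lemma meets_sublocale:
  assumes Y: "Y \<subseteq> pt"
  shows "meets Y \<in> sublocales"
  unfolding sublocales_def
proof (intro CollectI conjI allI impI ballI)
  fix Z assume Z: "Z \<subseteq> meets Y"
  let ?W = "Y \<inter> {Inf Z..}"
  have "Inf ?W \<le> z" if z: "z \<in> Z" for z
  proof -
    have "z \<in> meets Y"
      using Z z by blast
    then obtain X where X: "X \<subseteq> Y" "z = Inf X"
      unfolding in_meets_iff by blast
    have "X \<subseteq> ?W"
    proof
      fix y assume "y \<in> X"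
      then show "y \<in> ?W"
        using X Inf_lower[OF z] order_trans[of "Inf Z" z y] by (auto intro: Inf_lower)
    qed
    then show ?thesis
      using X(2) by (simp add: Inf_superset_mono)
  qed
  then have "Inf Z = Inf ?W"
    by (intro antisym) (auto intro!: Inf_greatest)
  then show "Inf Z \<in> meets Y"
    unfolding meets_def by blast
next
  fix s x assume "s \<in> meets Y"
  then obtain X where X: "X \<subseteq> Y" "s = Inf X"
    by (auto simp: in_meets_iff)
  have "heyting_imp x s = Inf {q \<in> X. \<not> x \<le> q}"
  proof (rule eqI_below)
    fix z
    have "inf z x \<le> q \<longleftrightarrow> (\<not> x \<le> q \<longrightarrow> z \<le> q)" if "q \<in> X" for q
      using that X Y by (subst pt_inf_le_iff) auto
    then show "z \<le> heyting_imp x s \<longleftrightarrow> z \<le> Inf {q \<in> X. \<not> x \<le> q}"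
      by (auto simp: X(2) le_heyting_imp_iff le_Inf_iff)
  qed
  then show "heyting_imp x s \<in> meets Y"
    using X(1) by (auto intro!: Inf_in_meets)
qed

lemma spatial_sublocale_iff:
  assumes S: "S \<in> sublocales"
  shows "spatial S \<longleftrightarrow> S \<subseteq> meets (pt \<inter> S)"
proof -
  have "P \<subseteq> pt \<inter> S \<and> isGlb S P a \<longleftrightarrow> P \<subseteq> pt \<inter> S \<and> a = Inf P" for P a
    using isGlb_sublocale_iff[OF S] by auto
  then show ?thesis
    unfolding spatial_def primes_sublocale[OF S] subset_eq[of S] in_meets_iff by simp
qed

lemma meets_pt_eq:
  assumes "S \<in> sublocales" "spatial S"
  shows "meets (pt \<inter> S) = S"
proof
  show "meets (pt \<inter> S) \<subseteq> S"
    using assms(1) by (simp add: meets_subset_sublocale)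
  show "S \<subseteq> meets (pt \<inter> S)"
    using assms spatial_sublocale_iff by blast
qed

lemma UNIV_sublocale: "UNIV \<in> sublocales"
  by (simp add: sublocales_def)

lemma spatial_UNIV_iff: "spatial (UNIV :: 'a::frame set) \<longleftrightarrow> (\<forall>a::'a. a = Inf (pt \<inter> {a..}))"
  unfolding spatial_sublocale_iff[OF UNIV_sublocale] meets_def Int_UNIV_right subset_eq by blast

section \<open>Boolean sublocales and essential primes\<close>

lemma boolean_sublocale_eq: "boolean_sublocale x = range (\<lambda>y. heyting_imp y x)"
proof
  let ?R = "range (\<lambda>y. heyting_imp y x)"
  have Inf: "Inf Z \<in> ?R" if Z: "Z \<subseteq> ?R" for Z
  proof -
    obtain W where W: "Z = (\<lambda>y. heyting_imp y x) ` W"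
      using Z unfolding subset_image_iff by blast
    have "Inf Z = heyting_imp (Sup W) x"
    proof (rule eqI_below)
      fix z
      have "z \<le> heyting_imp (Sup W) x \<longleftrightarrow> (\<forall>y\<in>W. inf z y \<le> x)"
        by (simp add: le_heyting_imp_iff inf_Sup_frame SUP_le_iff)
      then show "z \<le> Inf Z \<longleftrightarrow> z \<le> heyting_imp (Sup W) x"
        by (simp add: W le_INF_iff le_heyting_imp_iff)
    qed
    then show ?thesis by simp
  qed
  have "?R \<in> sublocales"
    using Inf by (auto simp: sublocales_def heyting_imp_heyting_imp)
  moreover have "x \<in> ?R"
    by (rule range_eqI[of _ _ top]) simp
  ultimately show "boolean_sublocale x \<subseteq> ?R"
    by (auto simp: boolean_sublocale_def)
  show "?R \<subseteq> boolean_sublocale x"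
    by (auto simp: boolean_sublocale_def sublocale_heyting_imp)
qed

lemma self_in_boolean_sublocale: "x \<in> boolean_sublocale x"
  by (simp add: boolean_sublocale_def)

lemma boolean_sublocale_least: "S \<in> sublocales \<Longrightarrow> x \<in> S \<Longrightarrow> boolean_sublocale x \<subseteq> S"
  by (auto simp: boolean_sublocale_def)

lemma boolean_sublocale_trivial_iff: "boolean_sublocale x = {top} \<longleftrightarrow> x = top"
proof
  assume "x = top"
  then show "boolean_sublocale x = {top}"
    using sublocale_top[OF boolean_sublocale_in_sublocales, of x]
    by (auto simp: boolean_sublocale_eq heyting_imp_eq_top_iff)
qed (use self_in_boolean_sublocale in blast)

lemma boolean_prime_iff:
  "(\<forall>x::'a::frame. boolean_sublocale x \<noteq> {top} \<longrightarrow> (\<exists>p\<in>pt. p \<in> boolean_sublocale x)) \<longleftrightarrow>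
   (\<forall>a::'a. a \<noteq> top \<longrightarrow> (\<exists>y. heyting_imp y a \<in> pt))"
proof -
  have "(\<exists>p\<in>pt. p \<in> boolean_sublocale x) \<longleftrightarrow> (\<exists>y. heyting_imp y x \<in> pt)" for x :: 'a
    by (auto simp: boolean_sublocale_eq)
  then show ?thesis
    by (simp add: boolean_sublocale_trivial_iff)
qed

text \<open>The assumption is applied to \<open>m \<rightarrow> a\<close> with \<open>m\<close> the meet in question, because
  \<open>y \<rightarrow> (m \<rightarrow> a) = (y \<sqinter> m) \<rightarrow> a\<close>: a prime obtained there is again in the Boolean sublocale of
  \<open>a\<close>, so that \<open>m\<close> is below it.\<close>

lemma Inf_boolean_primes:
  fixes a :: "'a::frame"
  assumes "\<forall>a::'a. a \<noteq> top \<longrightarrow> (\<exists>y. heyting_imp y a \<in> pt)"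
  shows "a = Inf (pt \<inter> boolean_sublocale a)"
proof (rule antisym)
  let ?m = "Inf (pt \<inter> boolean_sublocale a)"
  show "a \<le> ?m"
    by (auto intro!: Inf_greatest simp: boolean_sublocale_eq le_heyting_imp)
  show "?m \<le> a"
  proof (rule ccontr)
    assume "\<not> ?m \<le> a"
    then obtain y where y: "heyting_imp y (heyting_imp ?m a) \<in> pt"
      using assms heyting_imp_eq_top_iff by blast
    define p where "p = heyting_imp (inf y ?m) a"
    have p: "p \<in> pt" "p \<in> boolean_sublocale a"
      using y by (auto simp: p_def heyting_imp_heyting_imp boolean_sublocale_eq)
    then have "?m \<le> p"
      by (simp add: Inf_lower)
    then have "inf y ?m \<le> p"
      by (simp add: le_infI2)
    then show False
      using p(1) not_le_heyting_imp_pt unfolding p_def by blast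
  qed
qed

text \<open>With \<open>y\<close> the meet of the primes above \<open>a\<close> that are not above \<open>p\<close>, the element \<open>p \<sqinter> y\<close> is below
  all primes above \<open>a\<close>, hence below \<open>a\<close>, and essentiality says that \<open>y\<close> is not below \<open>p\<close>. This
  makes \<open>p\<close> equal to \<open>y \<rightarrow> a\<close>. In the other direction, \<open>p = y \<rightarrow> a\<close> gives \<open>p \<sqinter> y \<le> a\<close>, so the primes
  above \<open>a\<close> but not above \<open>p\<close> are above \<open>y\<close>, and \<open>y\<close> is not below \<open>p\<close>.\<close>

lemma essential_prime_iff:
  "essential_prime a p \<longleftrightarrow>
    a = Inf (pt \<inter> {a..}) \<and> p \<in> pt \<and> p \<in> boolean_sublocale a"
proof (intro iffI conjI)
  assume ess: "essential_prime a p"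
  let ?y = "Inf ((pt \<inter> {a..}) - {p..})"
  show a: "a = Inf (pt \<inter> {a..})" and p: "p \<in> pt"
    using ess by (auto simp: essential_prime_def)
  have "inf p ?y \<le> q" if "q \<in> pt \<inter> {a..}" for q
    using that by (cases "p \<le> q") (auto intro: le_infI1 le_infI2 Inf_lower)
  then have "inf p ?y \<le> a"
    by (subst a) (rule Inf_greatest)
  then have "p = heyting_imp ?y a"
    using ess by (intro pt_eq_heyting_impI) (auto simp: essential_prime_def)
  then show "p \<in> boolean_sublocale a"
    by (auto simp: boolean_sublocale_eq)
next
  assume *: "a = Inf (pt \<inter> {a..}) \<and> p \<in> pt \<and> p \<in> boolean_sublocale a"
  then obtain y where y: "p = heyting_imp y a"
    by (auto simp: boolean_sublocale_eq)
  have "y \<le> q" if q: "q \<in> (pt \<inter> {a..}) - {p..}" for q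
  proof -
    have "inf p y \<le> q"
      using q heyting_imp_inf_le[of y a] order_trans unfolding y by auto
    then show ?thesis
      using q by (simp add: pt_inf_le_iff)
  qed
  then have "y \<le> Inf ((pt \<inter> {a..}) - {p..})"
    by (rule Inf_greatest)
  then have "\<not> Inf ((pt \<inter> {a..}) - {p..}) \<le> p"
    using * not_le_heyting_imp_pt[of y a] order_trans unfolding y by blast
  then show "essential_prime a p"
    using * le_heyting_imp[of a y] by (auto simp: essential_prime_def y)
qed

text \<open>If \<open>q = z \<rightarrow> a\<close>, then \<open>z \<sqinter> q \<le> a \<le> p\<close>; here \<open>z \<le> p \<le> q\<close> would make \<open>q\<close> the top, so
  \<open>q \<le> p\<close>.\<close>

lemma essential_prime_minimal:
  assumes "essential_prime a q" "p \<in> pt" "a \<le> p" "p \<le> q"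
  shows "p = q"
proof -
  obtain z where z: "q = heyting_imp z a" and q: "q \<in> pt"
    using assms(1) by (auto simp: essential_prime_iff boolean_sublocale_eq)
  have "inf q z \<le> p"
    using heyting_imp_inf_le[of z a] assms(3) order_trans unfolding z by blast
  moreover have "\<not> z \<le> p"
    using not_le_heyting_imp_pt[of z a] q assms(4) order_trans unfolding z by blast
  ultimately show ?thesis
    using assms by (auto simp: pt_inf_le_iff)
qed

text \<open>A spatial Boolean sublocale with a non-top element must have a prime. Conversely a sublocale
  contains, along with \<open>a\<close>, the whole Boolean sublocale of \<open>a\<close>, hence enough primes to have \<open>a\<close> as
  a meet.\<close>

theorem totally_spatial_iff_boolean_prime:
  "totally_spatial TYPE('a::frame) \<longleftrightarrow> (\<forall>a::'a. a \<noteq> top \<longrightarrow> (\<exists>y. heyting_imp y a \<in> pt))"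
    (is "_ \<longleftrightarrow> ?R")
proof
  assume ts: "totally_spatial TYPE('a)"
  show ?R
  proof (intro allI impI)
    fix a :: 'a assume a: "a \<noteq> top"
    have "spatial (boolean_sublocale a)"
      using ts boolean_sublocale_in_sublocales by (auto simp: totally_spatial_def)
    then have "a \<in> meets (pt \<inter> boolean_sublocale a)"
      using self_in_boolean_sublocale
      by (auto simp: spatial_sublocale_iff boolean_sublocale_in_sublocales)
    then have "pt \<inter> boolean_sublocale a \<noteq> {}"
      using a by (auto simp: meets_def)
    then show "\<exists>y. heyting_imp y a \<in> pt"
      by (auto simp: boolean_sublocale_eq)
  qed
next
  assume R: ?R
  show "totally_spatial TYPE('a)"
    unfolding totally_spatial_def
  proof
    fix S :: "'a set" assume S: "S \<in> sublocales"
    have "a \<in> meets (pt \<inter> S)" if "a \<in> S" for a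
      using Inf_boolean_primes[OF R, of a] boolean_sublocale_least[OF S that]
      by (auto simp: in_meets_iff)
    then show "spatial S"
      by (auto simp: spatial_sublocale_iff S)
  qed
qed

lemma spatial_if_boolean_prime:
  assumes "\<forall>a::'a::frame. a \<noteq> top \<longrightarrow> (\<exists>y. heyting_imp y a \<in> pt)"
  shows "spatial (UNIV :: 'a set)"
proof -
  have "totally_spatial TYPE('a)"
    using assms totally_spatial_iff_boolean_prime by blast
  then show ?thesis
    by (simp add: totally_spatial_def UNIV_sublocale)
qed

section \<open>Discrete dense subspaces of closed sets of primes\<close>

lemma closedin_pt_subspace_iff:
  fixes Y :: "'a::frame set"
  assumes "Y \<subseteq> pt"
  shows "closedin (subtopology pt_space Y) C \<longleftrightarrow> (\<exists>a. C = Y \<inter> {a..})"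
proof -
  have "T \<subseteq> pt \<and> pt - T = {p \<in> pt. \<not> a \<le> p} \<longleftrightarrow> T = pt \<inter> {a..}" for T and a :: 'a
    by blast
  then have "closedin pt_space T \<longleftrightarrow> (\<exists>a. T = pt \<inter> {a..})" for T :: "'a set"
    unfolding closedin_def topspace_pt_space openin_pt_space by metis
  moreover have "pt \<inter> {a..} \<inter> Y = Y \<inter> {a..}" for a
    using assms by blast
  ultimately show ?thesis
    unfolding closedin_subtopology by metis
qed

lemma closure_of_pt_subspace:
  assumes "Y \<subseteq> pt" "D \<subseteq> Y"
  shows "subtopology pt_space Y closure_of D = Y \<inter> {Inf D..}"
proof (rule closure_of_unique)
  show "D \<subseteq> Y \<inter> {Inf D..}"
    using assms(2) by (auto simp: Inf_lower)
  show "Y \<inter> {Inf D..} \<subseteq> T" if T: "D \<subseteq> T" "closedin (subtopology pt_space Y) T" for T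
  proof -
    obtain a where a: "T = Y \<inter> {a..}"
      using T(2) closedin_pt_subspace_iff[OF assms(1)] by blast
    then have "a \<le> Inf D"
      using T(1) by (auto intro!: Inf_greatest)
    then show ?thesis
      using a by auto
  qed
qed (use closedin_pt_subspace_iff[OF assms(1), of "Y \<inter> {Inf D..}"] in blast)

lemma closedin_pt_space_iff:
  fixes C :: "'a::frame set"
  shows "closedin pt_space C \<longleftrightarrow> (\<exists>a. C = pt \<inter> {a..})"
  using closedin_pt_subspace_iff[of pt C] subtopology_topspace[of "pt_space :: 'a topology"]
  by (simp add: topspace_pt_space)

lemma discrete_pt_subspace_iff:
  assumes "D \<subseteq> pt"
  shows "subtopology pt_space D = discrete_topology D \<longleftrightarrow> (\<forall>p\<in>D. \<exists>z. {q \<in> D. \<not> z \<le> q} = {p})"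
proof -
  have "{q \<in> pt. \<not> z \<le> q} \<inter> D = {q \<in> D. \<not> z \<le> q}" for z
    using assms by blast
  then have "openin (subtopology pt_space D) {p} \<longleftrightarrow> (\<exists>z. {q \<in> D. \<not> z \<le> q} = {p})" for p
    unfolding openin_subtopology openin_pt_space by metis
  then show ?thesis
    using assms by (auto simp: eq_commute[of "subtopology pt_space D"] discrete_topology_unique
        topspace_pt_space Int_absorb1)
qed

text \<open>The essential primes of the meet of \<open>C\<close> are dense since they have the same meet. An essential
  prime \<open>p\<close> is isolated by the meet of the points of \<open>C\<close> that are not above \<open>p\<close>: by minimality, \<open>p\<close>
  is the only essential prime above \<open>p\<close>.\<close>

theorem discrete_dense_if_Inf_essential:
  fixes C :: "'a::frame set"
  assumes ess: "\<forall>a::'a. a = Inf {p. essential_prime a p}" and C: "closedin pt_space C"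
  shows "\<exists>D\<subseteq>C. subtopology pt_space D = discrete_topology D \<and>
    subtopology pt_space C closure_of D = C"
proof -
  obtain a0 where a0: "C = pt \<inter> {a0..}"
    using C by (auto simp: closedin_pt_space_iff)
  \<comment> \<open>Density compares meets, so \<open>C\<close> has to be represented by its own meet.\<close>
  define a where "a = Inf C"
  have Ca: "C = pt \<inter> {a..}"
    using a0 Inf_greatest[of C a0] by (auto simp: a_def intro: Inf_lower order_trans)
  define D where "D = {p. essential_prime a p}"
  have DC: "D \<subseteq> C"
    by (auto simp: D_def Ca essential_prime_def)
  have "\<exists>z. {q \<in> D. \<not> z \<le> q} = {p}" if "p \<in> D" for p
  proof -
    let ?z = "Inf (C - {p..})"
    have "q = p" if "q \<in> D" "\<not> ?z \<le> q" for q
    proof -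
      have "p \<le> q"
        using that DC by (meson DiffI Inf_lower atLeast_iff subsetD)
      then show ?thesis
        using \<open>q \<in> D\<close> \<open>p \<in> D\<close> DC essential_prime_minimal[of a q p] by (auto simp: D_def Ca)
    qed
    moreover have "\<not> ?z \<le> p"
      using \<open>p \<in> D\<close> by (auto simp: D_def Ca essential_prime_def)
    ultimately show ?thesis
      using \<open>p \<in> D\<close> by (intro exI[of _ ?z]) auto
  qed
  moreover have "subtopology pt_space C closure_of D = C"
    using ess DC closure_of_pt_subspace[of C D] by (auto simp: Ca D_def)
  ultimately show ?thesis
    using DC discrete_pt_subspace_iff[of D] by (intro exI[of _ D]) (auto simp: Ca)
qed

text \<open>A point \<open>p\<close> of a discrete dense subset \<open>D\<close> of the primes above \<open>a\<close> is isolated by some \<open>z\<close>: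
  all other points of \<open>D\<close> are above \<open>z\<close>, so \<open>p \<sqinter> z\<close> is below the meet of \<open>D\<close>, which is \<open>a\<close>.\<close>

theorem boolean_prime_if_discrete_dense:
  fixes a :: "'a::frame"
  assumes spatial: "spatial (UNIV :: 'a set)"
    and dense: "\<forall>C::'a set. closedin pt_space C \<longrightarrow>
         (\<exists>D\<subseteq>C. subtopology pt_space D = discrete_topology D \<and>
               (subtopology pt_space C) closure_of D = C)"
    and "a \<noteq> top"
  shows "\<exists>y. heyting_imp y a \<in> pt"
proof -
  let ?C = "pt \<inter> {a..}"
  have a: "a = Inf ?C"
    using spatial spatial_UNIV_iff by blast
  have "closedin pt_space ?C"
    using closedin_pt_space_iff by blast
  then obtain D where D: "D \<subseteq> ?C" "subtopology pt_space D = discrete_topology D"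
      "subtopology pt_space ?C closure_of D = ?C"
    using dense by meson
  have "?C \<subseteq> {Inf D..}"
    using D closure_of_pt_subspace[of ?C D] by auto
  then have "Inf D \<le> Inf ?C"
    by (auto intro!: Inf_greatest)
  then have DA: "Inf D \<le> a"
    using a by simp
  then have "D \<noteq> {}"
    using \<open>a \<noteq> top\<close> by (auto simp: top_unique)
  then obtain p where p: "p \<in> D" by blast
  then obtain z where z: "{q \<in> D. \<not> z \<le> q} = {p}"
    using D discrete_pt_subspace_iff[of D] by auto
  have "inf p z \<le> q" if "q \<in> D" for q
    using that z by (cases "q = p") (auto intro: le_infI1 le_infI2)
  then have "inf p z \<le> a"
    using DA Inf_greatest[of D "inf p z"] order_trans by blast
  then have "p = heyting_imp z a"
    using p z D(1) by (intro pt_eq_heyting_impI) auto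
  then show ?thesis
    using p D(1) by auto
qed

section \<open>Sober subspaces and spatial sublocales\<close>

lemma closure_of_pt_singleton:
  assumes "Y \<subseteq> pt" "p \<in> Y"
  shows "subtopology pt_space Y closure_of {p} = Y \<inter> {p..}"
  using assms closure_of_pt_subspace[of Y "{p}"] by simp

text \<open>An irreducible closed set is determined by its meet, which is a prime; it belongs to \<open>S\<close>
  because \<open>S\<close> is closed under meets, and it is the generic point.\<close>

lemma sober_pt_sublocale:
  assumes S: "S \<in> sublocales"
  shows "sober (subtopology pt_space (pt \<inter> S))"
  unfolding sober_def
proof (intro allI impI)
  let ?Y = "pt \<inter> S"
  let ?X = "subtopology pt_space ?Y"
  note closed_iff = closedin_pt_subspace_iff[of ?Y, OF Int_lower1]
  fix C assume C: "irreducible_closedin ?X C"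
  then obtain a where a: "C = ?Y \<inter> {a..}"
    unfolding irreducible_closedin_def closed_iff by blast
  define p where "p = Inf C"
  have Cp: "C = ?Y \<inter> {p..}"
    using a Inf_greatest[of C a] by (auto simp: p_def intro: Inf_lower order_trans)
  have "p \<in> S"
    using sublocale_Inf[OF S, of C] a by (auto simp: p_def)
  moreover have "p \<noteq> top"
  proof
    assume "p = top"
    then have "C \<subseteq> {top}"
      using Cp top_unique by auto
    moreover have "top \<notin> C"
      using a by (auto dest: pt_ne_top)
    ultimately show False
      using C by (auto simp: irreducible_closedin_def)
  qed
  moreover have "x \<le> p \<or> y \<le> p" if xy: "inf x y \<le> p" for x y
  proof -
    \<comment> \<open>The elements of \<open>C\<close> are primes above \<open>x \<sqinter> y\<close>, so two closed sets cover \<open>C\<close>.\<close>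
    have "x \<le> q \<or> y \<le> q" if "q \<in> C" for q
    proof -
      have "q \<in> pt" "inf x y \<le> q"
        using that xy Cp by auto
      then show ?thesis
        by (simp add: pt_inf_le_iff)
    qed
    then have "C \<subseteq> {x..} \<union> {y..}"
      by auto
    then have "C = ?Y \<inter> {sup p x..} \<union> ?Y \<inter> {sup p y..}"
      using Cp by auto
    then have "C = ?Y \<inter> {sup p x..} \<or> C = ?Y \<inter> {sup p y..}"
      using C unfolding irreducible_closedin_def closed_iff by blast
    then have "(\<forall>q\<in>C. x \<le> q) \<or> (\<forall>q\<in>C. y \<le> q)"
      by auto
    then show ?thesis
      by (simp add: p_def le_Inf_iff)
  qed
  ultimately have p: "p \<in> ?Y"
    by (simp add: mem_pt_iff)
  then have "C = ?X closure_of {p}"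
    using closure_of_pt_singleton[of ?Y p] Cp by simp
  moreover have "q = p" if "q \<in> ?Y" "C = ?X closure_of {q}" for q
  proof -
    have "?Y \<inter> {q..} = ?Y \<inter> {p..}"
      using closure_of_pt_singleton[of ?Y q] that Cp by simp
    then have "p \<in> {q..}" "q \<in> {p..}"
      using p that(1) by blast+
    then show ?thesis
      by simp
  qed
  ultimately show "\<exists>!x. x \<in> topspace ?X \<and> C = ?X closure_of {x}"
    using p by (intro ex1I[of _ p]) (auto simp: topspace_pt_space)
qed

text \<open>A prime \<open>p\<close> that is a meet of points of \<open>Y\<close> cuts out an irreducible closed subset of \<open>Y\<close>;
  the generic point of this set is its least element, hence its meet \<open>p\<close>.\<close>

lemma pt_meets_sober:
  assumes Y: "Y \<subseteq> pt" and sober: "sober (subtopology pt_space Y)"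
  shows "pt \<inter> meets Y = Y"
proof
  show "Y \<subseteq> pt \<inter> meets Y"
    using Y subset_meets by blast
  show "pt \<inter> meets Y \<subseteq> Y"
  proof
    fix p assume "p \<in> pt \<inter> meets Y"
    then have p: "p \<in> pt" "p = Inf (Y \<inter> {p..})"
      unfolding meets_def by blast+
    let ?X = "subtopology pt_space Y"
    let ?C = "Y \<inter> {p..}"
    note closed_iff = closedin_pt_subspace_iff[OF Y]
    have "irreducible_closedin ?X ?C"
      unfolding irreducible_closedin_def
    proof (intro conjI allI impI)
      show "closedin ?X ?C"
        using closed_iff by blast
      show "?C \<noteq> {}"
        using p pt_ne_top by (metis Inf_empty)
      fix A B assume AB: "closedin ?X A \<and> closedin ?X B \<and> ?C = A \<union> B"
      then obtain a b where ab: "A = Y \<inter> {a..}" "B = Y \<inter> {b..}"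
        unfolding closed_iff by blast
      have "inf a b \<le> Inf ?C"
      proof (rule Inf_greatest)
        fix q assume "q \<in> ?C"
        then have "a \<le> q \<or> b \<le> q"
          using AB ab by auto
        then show "inf a b \<le> q"
          by (auto intro: le_infI1 le_infI2)
      qed
      then have "a \<le> p \<or> b \<le> p"
        using p pt_inf_le_iff[of p a b] by simp
      then have "?C \<subseteq> A \<or> ?C \<subseteq> B"
        using ab by auto
      then show "?C = A \<or> ?C = B"
        using AB by blast
    qed
    then obtain y where y: "y \<in> topspace ?X" "?C = ?X closure_of {y}"
      using sober unfolding sober_def by blast
    then have "y \<in> Y" "?C = Y \<inter> {y..}"
      using closure_of_pt_singleton[OF Y, of y] by auto
    then have "Inf ?C = y"
      by (auto intro!: antisym Inf_lower Inf_greatest)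
    then show "p \<in> Y"
      using p \<open>y \<in> Y\<close> by simp
  qed
qed

lemma coframe_hom_order_iso:
  assumes bij: "bij_betw f A B" and ord: "\<And>x y. x \<in> A \<Longrightarrow> y \<in> A \<Longrightarrow> f x \<le> f y \<longleftrightarrow> x \<le> y"
  shows "coframe_hom A B f"
proof -
  have B: "B = f ` A"
    using bij by (simp add: bij_betw_def)
  show ?thesis
    unfolding coframe_hom_def isGlb_iff isLub_iff
  proof (intro conjI allI impI)
    show "f \<in> A \<rightarrow> B"
      using B by auto
  qed (auto simp: B ord subset_eq)
qed

lemma coframe_iso_order_iso:
  assumes bij: "bij_betw f A B" and ord: "\<And>x y. x \<in> A \<Longrightarrow> y \<in> A \<Longrightarrow> f x \<le> f y \<longleftrightarrow> x \<le> y"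
  shows "coframe_iso A B f"
  unfolding coframe_iso_def
proof (intro conjI)
  have "inv_into A f x \<le> inv_into A f y \<longleftrightarrow> x \<le> y" if "x \<in> B" "y \<in> B" for x y
    using that ord[of "inv_into A f x" "inv_into A f y"] bij
    by (metis bij_betw_def f_inv_into_f inv_into_into)
  then show "coframe_hom B A (inv_into A f)"
    using bij_betw_inv_into[OF bij] by (rule coframe_hom_order_iso[rotated])
qed (use assms coframe_hom_order_iso in blast)+

text \<open>The sublocale generated by the primes of \<open>S\<close> has the same primes as \<open>S\<close>, so injectivity
  forces \<open>S\<close> to be generated by them.\<close>

theorem totally_spatial_iff_coframe_iso:
  "totally_spatial TYPE('a::frame) \<longleftrightarrow>
    coframe_iso (sublocales :: 'a set set) (sober_subspaces pt_space) (\<lambda>S. pt \<inter> S)"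
proof
  assume "totally_spatial TYPE('a)"
  then have eq: "meets (pt \<inter> S) = S" if "S \<in> sublocales" for S :: "'a set"
    using that by (simp add: meets_pt_eq totally_spatial_def)
  have le: "pt \<inter> S \<le> pt \<inter> T \<longleftrightarrow> S \<le> T"
    if S: "S \<in> sublocales" and T: "T \<in> sublocales" for S T :: "'a set"
  proof
    assume "pt \<inter> S \<le> pt \<inter> T"
    then have "meets (pt \<inter> S) \<subseteq> T"
      using T by (intro meets_subset_sublocale) auto
    then show "S \<le> T"
      using eq[OF S] by simp
  qed auto
  show "coframe_iso (sublocales :: 'a set set) (sober_subspaces pt_space) (\<lambda>S. pt \<inter> S)"
  proof (rule coframe_iso_order_iso[OF _ le])
    show "bij_betw (\<lambda>S. pt \<inter> S) (sublocales :: 'a set set) (sober_subspaces pt_space)"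
    proof (rule bij_betwI')
      fix S T :: "'a set" assume "S \<in> sublocales" "T \<in> sublocales"
      then show "(pt \<inter> S = pt \<inter> T) = (S = T)"
        using eq by metis
    next
      fix S :: "'a set" assume "S \<in> sublocales"
      then show "pt \<inter> S \<in> sober_subspaces pt_space"
        by (auto simp: sober_subspaces_def topspace_pt_space sober_pt_sublocale)
    next
      fix Y :: "'a set" assume "Y \<in> sober_subspaces pt_space"
      then show "\<exists>S\<in>sublocales. Y = pt \<inter> S"
        using meets_sublocale[of Y] pt_meets_sober[of Y]
        by (auto simp: sober_subspaces_def topspace_pt_space)
    qed
  qed
next
  assume "coframe_iso (sublocales :: 'a set set) (sober_subspaces pt_space) (\<lambda>S. pt \<inter> S)"
  then have inj: "inj_on (\<lambda>S. pt \<inter> S) (sublocales :: 'a set set)"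
    by (auto simp: coframe_iso_def bij_betw_def)
  show "totally_spatial TYPE('a)"
    unfolding totally_spatial_def
  proof
    fix S :: "'a set" assume S: "S \<in> sublocales"
    let ?T = "meets (pt \<inter> S)"
    have "?T \<subseteq> S" "pt \<inter> S \<subseteq> ?T"
      using meets_subset_sublocale[OF S, of "pt \<inter> S"] subset_meets[of "pt \<inter> S"] by auto
    then have "pt \<inter> ?T = pt \<inter> S"
      by auto
    then have "?T = S"
      using inj S meets_sublocale[of "pt \<inter> S"] by (auto dest: inj_onD)
    then show "spatial S"
      using S by (simp add: spatial_sublocale_iff)
  qed
qed

section \<open>Primes of the opposite of the lattice of sublocales\<close>

lemma isGlb_dual_iff: "isGlb (dual ` A) (dual ` X) (dual m) \<longleftrightarrow> isLub A X m"
  by (auto simp: isGlb_iff isLub_iff dual_less_eq_iff)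

lemma dual_in_primes_iff:
  fixes A :: "'a::order set"
  shows "dual c \<in> primes (dual ` A) \<longleftrightarrow> c \<in> A \<and> \<not> isLub A {} c \<and>
    (\<forall>x\<in>A. \<forall>y\<in>A. \<forall>j. isLub A {x, y} j \<and> c \<le> j \<longrightarrow> c \<le> x \<or> c \<le> y)"
proof -
  have empty: "isGlb (dual ` A) {} (dual m) \<longleftrightarrow> isLub A {} m" for m
    using isGlb_dual_iff[of A "{}" m] by simp
  have pair: "isGlb (dual ` A) {dual x, dual y} (dual m) \<longleftrightarrow> isLub A {x, y} m" for m x y
    using isGlb_dual_iff[of A "{x, y}" m] by simp
  have le: "dual x \<le> dual y \<longleftrightarrow> y \<le> x" for x y :: 'a
    by (simp add: dual_less_eq_iff)
  have meet: "(\<forall>m. isGlb (dual ` A) {dual x, dual y} m \<and> m \<le> dual c \<longrightarrow> Q) \<longleftrightarrow>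
      (\<forall>j. isLub A {x, y} j \<and> c \<le> j \<longrightarrow> Q)" for x y Q
    using pair le by (metis dual_undual)
  have "dual c \<in> dual ` A \<longleftrightarrow> c \<in> A"
    by auto
  then show ?thesis
    unfolding primes_def mem_Collect_eq ball_simps meet empty le by blast
qed

lemma spatial_dual_iff:
  "spatial (dual ` A) \<longleftrightarrow> (\<forall>a\<in>A. \<exists>Q. dual ` Q \<subseteq> primes (dual ` A) \<and> isLub A Q a)"
proof -
  have "(\<exists>P\<subseteq>primes (dual ` A). isGlb (dual ` A) P (dual a)) \<longleftrightarrow>
      (\<exists>Q. dual ` Q \<subseteq> primes (dual ` A) \<and> isLub A Q a)" for a
    using isGlb_dual_iff[of A _ a] by (metis surj_dual subset_image_iff subset_UNIV)
  then show ?thesis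
    by (simp add: spatial_def)
qed

lemma singleton_top_sublocale: "{top} \<in> sublocales"
  by (auto simp: sublocales_def heyting_imp_eq_top_iff)

lemma pair_sublocale:
  assumes "p \<in> pt"
  shows "{top, p} \<in> sublocales"
  unfolding sublocales_def
proof (intro CollectI conjI allI impI ballI)
  fix X assume X: "X \<subseteq> {top, p}"
  show "Inf X \<in> {top, p}"
  proof (cases "p \<in> X")
    case True
    then have "Inf X = p"
      using X by (intro antisym Inf_lower Inf_greatest) auto
    then show ?thesis by simp
  next
    case False
    then have "Inf X = top"
      using X by auto
    then show ?thesis by simp
  qed
next
  fix s x assume "s \<in> {top, p}"
  then show "heyting_imp x s \<in> {top, p}"
    using assms by (auto simp: heyting_imp_pt heyting_imp_eq_top_iff split: if_splits)
qed

lemma prime_if_pair_sublocale: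
  assumes S: "{top, p} \<in> sublocales" and "p \<noteq> top"
  shows "p \<in> pt"
  unfolding mem_pt_iff
proof (intro conjI allI impI)
  fix x y assume "inf x y \<le> p"
  then have "y \<le> heyting_imp x p"
    by (simp add: le_heyting_imp_iff inf_commute)
  moreover have "heyting_imp x p \<in> {top, p}"
    using sublocale_heyting_imp[OF S] by blast
  ultimately show "x \<le> p \<or> y \<le> p"
    by (auto simp: heyting_imp_eq_top_iff)
qed fact

lemma isLub_empty_sublocales_iff: "isLub sublocales {} C \<longleftrightarrow> C = {top}"
proof
  assume "isLub sublocales {} C"
  then show "C = {top}"
    using singleton_top_sublocale sublocale_top[of C] by (auto simp: isLub_iff)
qed (auto simp: isLub_iff singleton_top_sublocale sublocale_top)

definition closed_sublocale :: "'a::frame \<Rightarrow> 'a set" where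
  "closed_sublocale a = {a..}"

text \<open>This set of fixed points is \<open>{a \<rightarrow> x | x}\<close>, because \<open>a \<rightarrow> _\<close> is idempotent.\<close>

definition open_sublocale :: "'a::frame \<Rightarrow> 'a set" where
  "open_sublocale a = {x. heyting_imp a x = x}"

lemma closed_sublocale_in_sublocales: "closed_sublocale a \<in> sublocales"
  by (auto simp: closed_sublocale_def sublocales_def le_heyting_imp_iff
      intro: Inf_greatest le_infI1)

lemma open_sublocale_in_sublocales: "open_sublocale a \<in> sublocales"
  unfolding sublocales_def open_sublocale_def
proof (intro CollectI conjI allI impI ballI)
  fix X assume "X \<subseteq> {x. heyting_imp a x = x}"
  then have "heyting_imp a ` X = (\<lambda>x. x) ` X"
    by (intro image_cong) auto
  then show "heyting_imp a (Inf X) = Inf X"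
    by (simp add: heyting_imp_Inf)
next
  fix s x assume "s \<in> {x. heyting_imp a x = x}"
  then have "heyting_imp x (heyting_imp a s) = heyting_imp x s"
    by simp
  then show "heyting_imp a (heyting_imp x s) = heyting_imp x s"
    by (simp add: heyting_imp_heyting_imp inf_commute)
qed

text \<open>Every \<open>x\<close> is the meet of \<open>x \<squnion> a\<close>, which lies in the closed part, and \<open>a \<rightarrow> x\<close>, which lies in the
  open part.\<close>

lemma closed_open_cover: "isLub sublocales {closed_sublocale a, open_sublocale a} UNIV"
proof -
  have "M = UNIV"
    if M: "M \<in> sublocales" "closed_sublocale a \<subseteq> M" "open_sublocale a \<subseteq> M" for M
  proof -
    have "x \<in> M" for x
    proof -
      have "inf (heyting_imp a x) (Sup {x, a}) \<le> x"
        by (subst inf_Sup_frame) (auto intro: heyting_imp_inf_le)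
      then have "x = inf (sup x a) (heyting_imp a x)"
        by (intro antisym) (auto simp: inf_commute le_heyting_imp)
      moreover have "sup x a \<in> M" "heyting_imp a x \<in> M"
        using M by (auto simp: closed_sublocale_def open_sublocale_def heyting_imp_heyting_imp)
      ultimately show ?thesis
        using sublocale_inf[OF M(1)] by metis
    qed
    then show ?thesis by blast
  qed
  then show ?thesis
    by (auto simp: isLub_iff UNIV_sublocale)
qed

lemma sublocale_binary_join:
  assumes A: "A \<in> sublocales" and B: "B \<in> sublocales"
  shows "{inf a b | a b. a \<in> A \<and> b \<in> B} \<in> sublocales" (is "?J \<in> _")
  unfolding sublocales_def
proof (intro CollectI conjI allI impI ballI)
  fix Z assume "Z \<subseteq> ?J"
  then obtain f g where fg: "\<And>z. z \<in> Z \<Longrightarrow> f z \<in> A \<and> g z \<in> B \<and> z = inf (f z) (g z)"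
    by (simp add: subset_eq) metis
  have "Inf Z = inf (Inf (f ` Z)) (Inf (g ` Z))"
  proof (rule eqI_below)
    fix w
    have "w \<le> z \<longleftrightarrow> w \<le> f z \<and> w \<le> g z" if "z \<in> Z" for z
      using fg[OF that] le_inf_iff by metis
    then show "w \<le> Inf Z \<longleftrightarrow> w \<le> inf (Inf (f ` Z)) (Inf (g ` Z))"
      by (auto simp: le_Inf_iff)
  qed
  moreover have "Inf (f ` Z) \<in> A" "Inf (g ` Z) \<in> B"
    using fg by (auto intro!: sublocale_Inf A B)
  ultimately show "\<exists>a b. Inf Z = inf a b \<and> a \<in> A \<and> b \<in> B"
    by blast
next
  fix s x assume "s \<in> ?J"
  then show "\<exists>a b. heyting_imp x s = inf a b \<and> a \<in> A \<and> b \<in> B"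
    using sublocale_heyting_imp[OF A] sublocale_heyting_imp[OF B] heyting_imp_inf by blast
qed

text \<open>If a prime \<open>p\<close> belongs to the join of \<open>A\<close> and \<open>B\<close>, it is a meet of an element of \<open>A\<close> and an
  element of \<open>B\<close>, hence equal to one of them. Conversely, take a sublocale \<open>C\<close> that is prime in the
  opposite order and has meet \<open>p\<close>. For \<open>d \<noteq> p\<close> in \<open>C\<close>, the closed sublocale of \<open>d\<close> omits \<open>p\<close>, so the
  open one contains \<open>C\<close>. Then \<open>d = (d \<rightarrow> d) = 1\<close>, and \<open>C = {1, p}\<close>.\<close>

lemma prime_dual_sublocales_iff:
  "dual C \<in> primes (dual ` sublocales) \<longleftrightarrow> (\<exists>p\<in>pt. C = {top, p})"
proof
  assume "dual C \<in> primes (dual ` sublocales)"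
  then have C: "C \<in> sublocales" "C \<noteq> {top}"
    and coprime: "\<And>A B J. A \<in> sublocales \<Longrightarrow> B \<in> sublocales \<Longrightarrow> isLub sublocales {A, B} J \<Longrightarrow>
      C \<subseteq> J \<Longrightarrow> C \<subseteq> A \<or> C \<subseteq> B"
    unfolding dual_in_primes_iff isLub_empty_sublocales_iff by blast+
  have split: "C \<subseteq> closed_sublocale a \<or> C \<subseteq> open_sublocale a" for a
    using coprime[OF closed_sublocale_in_sublocales open_sublocale_in_sublocales
        closed_open_cover subset_UNIV] .
  define p where "p = Inf C"
  have pC: "p \<in> C"
    using sublocale_Inf[OF C(1)] by (auto simp: p_def)
  have "d = top" if d: "d \<in> C" "d \<noteq> p" for d
  proof -
    have "p \<le> d"
      using d by (simp add: p_def Inf_lower)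
    then have "\<not> C \<subseteq> closed_sublocale d"
      using d pC by (auto simp: closed_sublocale_def)
    then have "heyting_imp d d = d"
      using split d by (auto simp: open_sublocale_def)
    then show ?thesis
      using heyting_imp_eq_top_iff[of d d] by simp
  qed
  then have eq: "C = {top, p}"
    using pC sublocale_top[OF C(1)] by auto
  moreover have "p \<in> pt"
    using prime_if_pair_sublocale[of p] C eq by auto
  ultimately show "\<exists>p\<in>pt. C = {top, p}" by blast
next
  assume "\<exists>p\<in>pt. C = {top, p}"
  then obtain p where p: "p \<in> pt" and C: "C = {top, p}" by blast
  have "C \<subseteq> A \<or> C \<subseteq> B"
    if A: "A \<in> sublocales" and B: "B \<in> sublocales"
      and J: "isLub sublocales {A, B} J" "C \<subseteq> J" for A B J
  proof -
    let ?J = "{inf a b | a b. a \<in> A \<and> b \<in> B}"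
    have "x \<in> ?J" if "x \<in> A \<union> B" for x
      using that sublocale_top[OF A] sublocale_top[OF B] inf_top_left[of x] inf_top_right[of x]
      unfolding mem_Collect_eq by (metis UnE)
    then have "A \<subseteq> ?J" "B \<subseteq> ?J"
      by blast+
    then have "J \<subseteq> ?J"
      using J(1) sublocale_binary_join[OF A B] by (auto simp: isLub_iff)
    then obtain a b where ab: "p = inf a b" "a \<in> A" "b \<in> B"
      using J(2) C by auto
    then have "a \<le> p \<or> b \<le> p"
      using pt_inf_le_iff[OF p, of a b] by simp
    then have "p = a \<or> p = b"
      using ab(1) by (metis inf.absorb_iff1 inf.absorb_iff2 antisym inf_le1 inf_le2)
    then show ?thesis
      using ab C sublocale_top[OF A] sublocale_top[OF B] by auto
  qed
  moreover have "C \<in> sublocales" "C \<noteq> {top}"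
    using C p pair_sublocale pt_ne_top by auto
  ultimately show "dual C \<in> primes (dual ` sublocales)"
    unfolding dual_in_primes_iff isLub_empty_sublocales_iff by blast
qed

text \<open>The join of the sublocales \<open>{1, p}\<close> with \<open>p\<close> a prime in \<open>S\<close> is the sublocale generated by these
  primes, and \<open>S\<close> is spatial iff it is equal to this sublocale.\<close>

theorem totally_spatial_iff_spatial_dual:
  "totally_spatial TYPE('a::frame) \<longleftrightarrow> spatial (dual ` (sublocales :: 'a set set))"
proof
  assume ts: "totally_spatial TYPE('a)"
  show "spatial (dual ` (sublocales :: 'a set set))"
    unfolding spatial_dual_iff
  proof
    fix S :: "'a set" assume S: "S \<in> sublocales"
    let ?Q = "(\<lambda>p. {top, p}) ` (pt \<inter> S)"
    have "S \<subseteq> U" if U: "U \<in> sublocales" "\<forall>x\<in>?Q. x \<subseteq> U" for U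
    proof -
      have "meets (pt \<inter> S) \<subseteq> U"
        using U by (intro meets_subset_sublocale) auto
      then show ?thesis
        using ts S by (simp add: meets_pt_eq totally_spatial_def)
    qed
    then have "isLub sublocales ?Q S"
      using S sublocale_top[OF S] by (auto simp: isLub_iff)
    moreover have "dual ` ?Q \<subseteq> primes (dual ` sublocales)"
      by (auto simp: prime_dual_sublocales_iff)
    ultimately show "\<exists>Q. dual ` Q \<subseteq> primes (dual ` sublocales) \<and> isLub sublocales Q S"
      by blast
  qed
next
  assume sp: "spatial (dual ` (sublocales :: 'a set set))"
  show "totally_spatial TYPE('a)"
    unfolding totally_spatial_def
  proof
    fix S :: "'a set" assume S: "S \<in> sublocales"
    then obtain Q where Q: "dual ` Q \<subseteq> primes (dual ` sublocales)" "isLub sublocales Q S"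
      using sp unfolding spatial_dual_iff by blast
    let ?T = "meets (pt \<inter> S)"
    have T: "?T \<in> sublocales"
      by (simp add: meets_sublocale)
    have "C \<subseteq> ?T" if C: "C \<in> Q" for C
    proof -
      obtain p where "p \<in> pt" "C = {top, p}"
        using Q(1) C prime_dual_sublocales_iff[of C] by auto
      moreover have "C \<subseteq> S"
        using Q(2) C by (auto simp: isLub_iff)
      ultimately show ?thesis
        using subset_meets[of "pt \<inter> S"] sublocale_top[OF T] by auto
    qed
    then show "spatial S"
      using Q(2) T by (auto simp: isLub_iff spatial_sublocale_iff S)
  qed
qed

section \<open>Characterizations of total spatiality\<close>

theorem theorem5p21:
  shows "all_equivalent
    [totally_spatial TYPE('a::frame),
     spatial (dual ` (sublocales :: 'a set set)),
     coframe_iso (sublocales :: 'a set set) (sober_subspaces pt_space) (\<lambda>S. pt \<inter> S),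
     \<forall>x::'a. boolean_sublocale x \<noteq> {top} \<longrightarrow> (\<exists>p\<in>pt. p \<in> boolean_sublocale x),
     spatial (UNIV :: 'a set) \<and> (\<forall>a::'a. a \<noteq> top \<longrightarrow> (\<exists>p. essential_prime a p)),
     spatial (UNIV :: 'a set) \<and> (\<forall>a::'a. a \<noteq> top \<longrightarrow> (\<exists>y. heyting_imp y a \<in> pt)),
     \<forall>a::'a. a = Inf {p. essential_prime a p},
     spatial (UNIV :: 'a set) \<and>
       (\<forall>C::'a set. closedin pt_space C \<longrightarrow>
         (\<exists>D\<subseteq>C. subtopology pt_space D = discrete_topology D \<and>
               (subtopology pt_space C) closure_of D = C))]"
    (is "all_equivalent [?total, ?dual, ?iso, ?bool, ?ess, ?imp, ?Inf, ?discrete]")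
proof -
  let ?prime = "\<forall>a::'a. a \<noteq> top \<longrightarrow> (\<exists>y. heyting_imp y a \<in> pt)"
  have imp: "?imp \<longleftrightarrow> ?prime"
    using spatial_if_boolean_prime by blast
  have ess_iff: "essential_prime a p \<longleftrightarrow> p \<in> pt \<inter> boolean_sublocale a"
    if "spatial (UNIV :: 'a set)" for a p :: 'a
    using that by (simp add: essential_prime_iff spatial_UNIV_iff[THEN iffD1, rule_format, symmetric])
  have "(\<exists>p. essential_prime a p) \<longleftrightarrow> (\<exists>y. heyting_imp y a \<in> pt)"
    if "spatial (UNIV :: 'a set)" for a :: 'a
    using ess_iff[OF that] by (auto simp: boolean_sublocale_eq)
  then have ess: "?ess \<longleftrightarrow> ?prime"
    using spatial_if_boolean_prime by blast
  \<comment> \<open>The primes above \<open>a\<close> include the essential ones, so their meet is \<open>a\<close> as well.\<close>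
  have spatial: "spatial (UNIV :: 'a set)" if ?Inf
  proof -
    have "Inf (pt \<inter> {a..}) \<le> Inf {p. essential_prime a p}" for a :: 'a
      by (intro Inf_superset_mono) (auto simp: essential_prime_def)
    then have "Inf (pt \<inter> {a..}) \<le> a" for a :: 'a
      using that by metis
    then show ?thesis
      unfolding spatial_UNIV_iff by (auto intro!: antisym Inf_greatest)
  qed
  have Inf_prime: "?prime" if ?Inf
  proof -
    have "\<exists>p. essential_prime a p" if "a \<noteq> top" for a :: 'a
      using \<open>?Inf\<close> that by (metis Collect_empty_eq Inf_empty)
    then show ?thesis
      using ess spatial[OF that] by blast
  qed
  have prime_Inf: "?Inf" if ?prime
  proof
    fix a :: 'a
    have "{p. essential_prime a p} = pt \<inter> boolean_sublocale a"
      using ess_iff[OF spatial_if_boolean_prime[OF that]] by blast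
    then show "a = Inf {p. essential_prime a p}"
      using Inf_boolean_primes[OF that, of a] by metis
  qed
  have discrete: "?discrete \<longleftrightarrow> ?prime"
  proof
    assume ?prime
    then have Inf: ?Inf by (rule prime_Inf)
    show ?discrete
      using spatial[OF Inf] discrete_dense_if_Inf_essential[OF Inf] by simp
  next
    assume d: ?discrete
    show ?prime
      using boolean_prime_if_discrete_dense[OF conjunct1[OF d] conjunct2[OF d]] by simp
  qed
  have total: "?total \<longleftrightarrow> ?prime"
    by (rule totally_spatial_iff_boolean_prime)
  have dual: "?dual \<longleftrightarrow> ?prime"
    using totally_spatial_iff_spatial_dual[where 'a = 'a] total by simp
  have iso: "?iso \<longleftrightarrow> ?prime"
    using totally_spatial_iff_coframe_iso[where 'a = 'a] total by simp
  have Inf: "?Inf \<longleftrightarrow> ?prime"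
    using Inf_prime prime_Inf by (rule iffI)
  show ?thesis
    unfolding all_equivalent_def total dual iso boolean_prime_iff ess imp Inf discrete by simp
qed

end
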